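(* Consider a row of $n$ seats with two entrances, one at each end, filled by selfish theatregoers who choose seats uniformly at random among the accessible empty seats (model described in the context). Let $F_n$ be the expected number of occupied seats when the process ends. Then $F_n$ is asymptotically $2\ln n$, i.e. $F_n/(2\ln n)\to 1$ as $n\to\infty$.
   Context: Row model: a row consists of $n$ seats numbered $1,\dots,n$ from left to right, with entrances at both ends. Theatregoers arrive one at a time. A selfish theatregoer, once seated, never gets up, so no later theatregoer can walk past her seat. An empty seat is accessible if it can be reached from some entrance without passing a seat occupied by a selfish theatregoer. Each arriving theatregoer sits in an accessible empty seat chosen uniformly at random among all accessible empty seats; the process ends when no accessible empty seat remains. Here all theatregoers are selfish. *)

theory Defs
  imports "HOL-Probability.Probability"
begin

text \<open>
  Seats are the numbers \<open>1, \<dots>, n\<close>; a state of the row is the set \<open>S\<close> of occupied seats.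
  All theatregoers are selfish, so every occupied seat blocks passage.
\<close>

definition reachable_from_left :: "nat set \<Rightarrow> nat \<Rightarrow> bool" where
  "reachable_from_left S s \<longleftrightarrow> (\<forall>t\<in>{1..<s}. t \<notin> S)"

definition reachable_from_right :: "nat \<Rightarrow> nat set \<Rightarrow> nat \<Rightarrow> bool" where
  "reachable_from_right n S s \<longleftrightarrow> (\<forall>t\<in>{s<..n}. t \<notin> S)"

definition accessible :: "nat \<Rightarrow> nat set \<Rightarrow> nat set" where
  "accessible n S =
     {s \<in> {1..n}. s \<notin> S \<and> (reachable_from_left S s \<or> reachable_from_right n S s)}"

lemma finite_accessible: "finite (accessible n S)"
  by (simp add: accessible_def)

text \<open>Distribution of the final set of occupied seats, when the process is started from \<open>S\<close>.\<close>

function final_seating :: "nat \<Rightarrow> nat set \<Rightarrow> nat set pmf" where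
  "final_seating n S =
     (if accessible n S = {} then return_pmf S
      else bind_pmf (pmf_of_set (accessible n S)) (\<lambda>s. final_seating n (insert s S)))"
  by pat_completeness auto

termination
proof (relation "Wellfounded.measure (\<lambda>(n, S). card ({1..n} - S))")
  fix n :: nat and S :: "nat set" and s :: nat
  assume ne: "accessible n S \<noteq> {}" and "s \<in> set_pmf (pmf_of_set (accessible n S))"
  then have "s \<in> accessible n S"
    by (simp add: finite_accessible)
  then have "s \<in> {1..n} - S"
    by (simp add: accessible_def)
  then have "{1..n} - insert s S \<subset> {1..n} - S"
    by blast
  then have "card ({1..n} - insert s S) < card ({1..n} - S)"
    by (intro psubset_card_mono) auto
  then show "((n, insert s S), (n, S)) \<in> Wellfounded.measure (\<lambda>(n, S). card ({1..n} - S))"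
    by simp
qed simp

declare final_seating.simps [simp del]

definition expected_occupied :: "nat \<Rightarrow> real" where
  "expected_occupied n = measure_pmf.expectation (final_seating n {}) (\<lambda>S. real (card S))"

end

theory Submission
  imports Defs
begin

text \<open>
  Once somebody sits, with \<open>a\<close> free seats left of the leftmost and \<open>b\<close> free seats right of the
  rightmost occupied seat, the next person is uniform on these \<open>a + b\<close> seats, and a choice on one
  side leaves the other side untouched. The two sides thus behave like independent one-entrance
  rows, so that \<open>H\<^sub>a + H\<^sub>b\<close> further seats are filled on average. Averaging over the first
  seat gives \<open>F\<^sub>n = 2 H\<^sub>n - 1\<close>.
\<close>

lemma sum_pred_atLeastLessThan:
  fixes f :: "nat \<Rightarrow> 'a::comm_monoid_add"
  shows "(\<Sum>s\<in>{1..<m}. f (s - 1)) = (\<Sum>k<m - 1. f k)"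
  by (rule sum.reindex_bij_witness[of _ Suc "\<lambda>s. s - 1"]) auto

lemma sum_diff_greaterThanAtMost:
  fixes f :: "nat \<Rightarrow> 'a::comm_monoid_add"
  shows "(\<Sum>s\<in>{m<..n}. f (n - s)) = (\<Sum>k<n - m. f k)"
  by (rule sum.reindex_bij_witness[of _ "\<lambda>k. n - k" "\<lambda>s. n - s"]) auto

lemma sum_harm_lessThan:
  "(\<Sum>k<n. harm k) = (of_nat n * (harm n - 1) :: 'a::real_normed_field)"
proof (induction n)
  case (Suc n)
  have "of_nat (Suc n) * harm (Suc n) = (of_nat (Suc n) * harm n + 1 :: 'a)"
    by (simp add: harm_Suc distrib_left del: of_nat_Suc)
  with Suc show ?case
    by (simp add: algebra_simps)
qed simp

lemma filterlim_ln_real_sequentially: "filterlim (\<lambda>n. ln (real n)) at_top sequentially"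
  by (rule filterlim_compose[OF ln_at_top filterlim_real_sequentially])

lemma harm_over_ln_LIMSEQ: "(\<lambda>n. harm n / ln (real n)) \<longlonglongrightarrow> 1"
proof -
  have "(\<lambda>n. (harm n - ln (real n)) / ln (real n)) \<longlonglongrightarrow> 0"
    by (rule real_tendsto_divide_at_top[OF euler_mascheroni_LIMSEQ filterlim_ln_real_sequentially])
  then have "(\<lambda>n. 1 + (harm n - ln (real n)) / ln (real n)) \<longlonglongrightarrow> 1"
    using tendsto_add[OF tendsto_const] by fastforce
  moreover have "\<forall>\<^sub>F n in sequentially.
      1 + (harm n - ln (real n)) / ln (real n) = harm n / ln (real n)"
    using eventually_ge_at_top[of 2] by eventually_elim (simp add: diff_divide_distrib)
  ultimately show ?thesis
    by (rule Lim_transform_eventually)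
qed

lemma final_seating_terminal: "accessible n S = {} \<Longrightarrow> final_seating n S = return_pmf S"
  by (subst final_seating.simps) simp

lemma final_seating_step:
  "accessible n S \<noteq> {} \<Longrightarrow>
    final_seating n S = pmf_of_set (accessible n S) \<bind> (\<lambda>s. final_seating n (insert s S))"
  by (subst final_seating.simps) simp

lemma finite_set_pmf_final_seating: "finite (set_pmf (final_seating n S))"
proof (induction n S rule: final_seating.induct)
  case (1 n S)
  then show ?case
    by (subst final_seating.simps) (auto simp: finite_accessible)
qed

lemma expectation_final_seating_step:
  fixes h :: "nat set \<Rightarrow> 'a::{banach, second_countable_topology}"
  assumes "accessible n S \<noteq> {}"
  shows "measure_pmf.expectation (final_seating n S) h =
    (\<Sum>s\<in>accessible n S. measure_pmf.expectation (final_seating n (insert s S)) h)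
      /\<^sub>R real (card (accessible n S))"
  using assms
  by (simp add: final_seating_step pmf_expectation_bind_pmf_of_set finite_accessible
      finite_set_pmf_final_seating scaleR_sum_right)

text \<open>
  The values of \<open>f\<close> along the process form a martingale that ends in \<open>h\<close>.
\<close>

lemma expectation_final_seating_eqI:
  fixes f h :: "nat set \<Rightarrow> 'a::{banach, second_countable_topology}"
  assumes "P S"
    and "\<And>S s. P S \<Longrightarrow> s \<in> accessible n S \<Longrightarrow> P (insert s S)"
    and "\<And>S. P S \<Longrightarrow> accessible n S = {} \<Longrightarrow> f S = h S"
    and "\<And>S. P S \<Longrightarrow>
      (\<Sum>s\<in>accessible n S. f (insert s S)) = real (card (accessible n S)) *\<^sub>R f S"
  shows "measure_pmf.expectation (final_seating n S) h = f S"
  using assms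
proof (induction n S rule: final_seating.induct)
  case (1 n S)
  show ?case
  proof (cases "accessible n S = {}")
    case True
    then show ?thesis
      using "1.prems" by (simp add: final_seating_terminal)
  next
    case False
    have "measure_pmf.expectation (final_seating n (insert s S)) h = f (insert s S)"
      if "s \<in> accessible n S" for s
      using "1.IH"[OF False] "1.prems" that False by (simp add: finite_accessible)
    then show ?thesis
      using False "1.prems"(1,4)
      by (simp add: expectation_final_seating_step finite_accessible)
  qed
qed

lemma accessible_empty: "accessible n {} = {0<..n}"
  by (auto simp: accessible_def reachable_from_left_def)

lemma accessible_nonempty:
  assumes "S \<subseteq> {1..n}" "S \<noteq> {}"
  shows "accessible n S = {1..<Min S} \<union> {Max S<..n}"
proof -
  have fin: "finite S"
    using assms finite_subset by blast
  have bounds: "1 \<le> t" "t \<le> n" if "t \<in> S" for t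
    using assms that by auto
  have left: "s \<notin> S \<and> reachable_from_left S s \<longleftrightarrow> s < Min S" for s
    using bounds unfolding reachable_from_left_def Min_gr_iff[OF fin assms(2)]
    by (metis atLeastLessThan_iff linorder_neqE_nat order.asym)
  have right: "s \<notin> S \<and> reachable_from_right n S s \<longleftrightarrow> Max S < s" for s
    using bounds unfolding reachable_from_right_def Max_less_iff[OF fin assms(2)]
    by (metis greaterThanAtMost_iff linorder_neqE_nat order.asym)
  have range: "Min S \<le> n" "1 \<le> Max S"
    using bounds(2)[OF Min_in] bounds(1)[OF Max_in] fin assms(2) by simp_all
  have "accessible n S = {s \<in> {1..n}. s < Min S \<or> Max S < s}"
    unfolding accessible_def left[symmetric] right[symmetric] by blast
  also have "\<dots> = {1..<Min S} \<union> {Max S<..n}"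
    using range by auto
  finally show ?thesis .
qed

lemma sum_accessible_nonempty:
  fixes f :: "nat \<Rightarrow> 'a::comm_monoid_add"
  assumes "S \<subseteq> {1..n}" "S \<noteq> {}"
  shows "(\<Sum>s\<in>accessible n S. f s) = (\<Sum>s\<in>{1..<Min S}. f s) + (\<Sum>s\<in>{Max S<..n}. f s)"
proof -
  have "Min S \<le> Max S"
    using assms finite_subset[of S] by auto
  then have "{1..<Min S} \<inter> {Max S<..n} = {}"
    by auto
  then show ?thesis
    using assms by (simp add: accessible_nonempty sum.union_disjoint)
qed

text \<open>Meaningful only for nonempty \<open>S\<close>, since \<open>Min {}\<close> and \<open>Max {}\<close> are unspecified.\<close>

definition predicted_occupied :: "nat \<Rightarrow> nat set \<Rightarrow> real" where
  "predicted_occupied n S = real (card S) + harm (Min S - 1) + harm (n - Max S)"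

lemma predicted_occupied_insert_left:
  assumes "finite S" "S \<noteq> {}" "s < Min S"
  shows "predicted_occupied n (insert s S) =
    real (card S) + 1 + harm (s - 1) + harm (n - Max S)"
proof -
  have "s \<notin> S" "s < Max S"
    using assms by (auto intro: less_le_trans)
  then show ?thesis
    using assms by (simp add: predicted_occupied_def)
qed

lemma predicted_occupied_insert_right:
  assumes "finite S" "S \<noteq> {}" "Max S < s"
  shows "predicted_occupied n (insert s S) =
    real (card S) + 1 + harm (Min S - 1) + harm (n - s)"
proof -
  have "s \<notin> S" "Min S < s"
    using assms by (auto intro: le_less_trans)
  then show ?thesis
    using assms by (simp add: predicted_occupied_def)
qed

lemma sum_predicted_occupied_insert:
  assumes "S \<subseteq> {1..n}" "S \<noteq> {}"
  shows "(\<Sum>s\<in>accessible n S. predicted_occupied n (insert s S)) =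
    real (card (accessible n S)) * predicted_occupied n S"
proof -
  define a b where "a = Min S - 1" and "b = n - Max S"
  have fin: "finite S"
    using assms finite_subset by blast
  have card: "card (accessible n S) = a + b"
    using sum_accessible_nonempty[OF assms, of "\<lambda>_. 1::nat"] by (simp add: a_def b_def)
  have left: "(\<Sum>s\<in>{1..<Min S}. harm (s - 1)) = real a * (harm a - 1)"
    by (simp only: a_def sum_pred_atLeastLessThan sum_harm_lessThan)
  have right: "(\<Sum>s\<in>{Max S<..n}. harm (n - s)) = real b * (harm b - 1)"
    by (simp only: b_def sum_diff_greaterThanAtMost sum_harm_lessThan)
  have "(\<Sum>s\<in>accessible n S. predicted_occupied n (insert s S)) =
      (\<Sum>s\<in>{1..<Min S}. real (card S) + 1 + harm (s - 1) + harm b) +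
      (\<Sum>s\<in>{Max S<..n}. real (card S) + 1 + harm a + harm (n - s))"
    using assms fin
    by (simp add: sum_accessible_nonempty predicted_occupied_insert_left
        predicted_occupied_insert_right a_def b_def)
  also have "\<dots> = real (a + b) * (real (card S) + harm a + harm b)"
    using left right by (simp add: sum.distrib a_def b_def algebra_simps)
  finally show ?thesis
    by (simp add: card predicted_occupied_def a_def b_def)
qed

lemma expectation_card_final_seating:
  assumes "S \<subseteq> {1..n}" "S \<noteq> {}"
  shows "measure_pmf.expectation (final_seating n S) (\<lambda>T. real (card T)) =
    predicted_occupied n S"
proof (rule expectation_final_seating_eqI[where P = "\<lambda>S. S \<subseteq> {1..n} \<and> S \<noteq> {}"])
  show "S \<subseteq> {1..n} \<and> S \<noteq> {}"
    using assms by simp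
next
  fix S s
  assume "S \<subseteq> {1..n} \<and> S \<noteq> {}" "s \<in> accessible n S"
  then show "insert s S \<subseteq> {1..n} \<and> insert s S \<noteq> {}"
    by (auto simp: accessible_def)
next
  fix S
  assume "S \<subseteq> {1..n} \<and> S \<noteq> {}" "accessible n S = {}"
  then have "Min S - 1 = 0" "n - Max S = 0"
    by (auto simp: accessible_nonempty)
  then show "predicted_occupied n S = real (card S)"
    by (simp add: predicted_occupied_def harm_expand)
next
  fix S
  assume "S \<subseteq> {1..n} \<and> S \<noteq> {}"
  then show "(\<Sum>s\<in>accessible n S. predicted_occupied n (insert s S)) =
      real (card (accessible n S)) *\<^sub>R predicted_occupied n S"
    by (simp add: sum_predicted_occupied_insert)
qed

theorem expected_occupied_eq:
  assumes "n \<ge> 1"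
  shows "expected_occupied n = 2 * harm n - 1"
proof -
  have "expected_occupied n = (\<Sum>s\<in>{0<..n}. predicted_occupied n {s}) / real n"
    using assms
    by (simp add: expected_occupied_def expectation_final_seating_step accessible_empty
        expectation_card_final_seating divide_inverse mult.commute)
  also have "(\<Sum>s\<in>{0<..n}. predicted_occupied n {s}) =
      real n + (\<Sum>s\<in>{1..<Suc n}. harm (s - 1)) + (\<Sum>s\<in>{0<..n}. harm (n - s))"
    by (simp add: predicted_occupied_def sum.distrib atLeastLessThanSuc_atLeastAtMost
        flip: atLeastSucAtMost_greaterThanAtMost)
  also have "\<dots> = real n * (2 * harm n - 1)"
    by (simp only: sum_pred_atLeastLessThan sum_diff_greaterThanAtMost)
      (simp add: sum_harm_lessThan algebra_simps)
  finally show ?thesis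
    using assms by simp
qed

theorem theorem2: "(\<lambda>n. expected_occupied n / (2 * ln (real n))) \<longlonglongrightarrow> 1"
proof -
  have "(\<lambda>n. (1 / 2) / ln (real n)) \<longlonglongrightarrow> 0"
    by (rule real_tendsto_divide_at_top[OF tendsto_const filterlim_ln_real_sequentially])
  from tendsto_diff[OF harm_over_ln_LIMSEQ this]
  have "(\<lambda>n. harm n / ln (real n) - (1 / 2) / ln (real n)) \<longlonglongrightarrow> 1"
    by simp
  moreover have "\<forall>\<^sub>F n in sequentially.
      harm n / ln (real n) - (1 / 2) / ln (real n) = expected_occupied n / (2 * ln (real n))"
    using eventually_ge_at_top[of 1]
    by eventually_elim (simp add: expected_occupied_eq diff_divide_distrib)
  ultimately show ?thesis
    by (rule Lim_transform_eventually)
qed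

end
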